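(* Let $D\in\mathbb{N}$, $E_0,\ldots,E_D\in\mathbb{R}$ and $\beta\in\mathbb{R}$. There is a unique (probability) measure $P_\infty$ on $\mathbb{T}$ that is consistent with the measures $P_n$, i.e. such that $$P_\infty\pi_n^{-1}=P_n\quad\text{for all } n\in\mathbb{N},$$ where $\pi_n T$ denotes the root's neighbourhood of height $n$ (the subtree spanned by all vertices of height at most $n$) of a tree $T\in\mathbb{T}$. This measure is concentrated on $S_\infty$, the set of infinite plane trees with branching numbers bounded by $D$.
   Context: $\mathbb{N}=\{1,2,\ldots\}$. A plane tree (ordered tree) is a rooted tree in which the child subtrees of every vertex are linearly ordered (trees are considered up to isomorphism preserving the root and these orders). The branching number $\deg(v)$ of a vertex $v$ is its number of children; the height of $v$ is its distance to the root; the height of a finite tree is the maximal height of its vertices. $\mathbb{T}_N$ is the set of all plane trees on $N$ vertices with all branching numbers at most $D$. For a finite tree $T$ with vertex set $V(T)$, $E(T)=\sum_{v\in V(T)}E_{\deg(v)}$. The probability measure $\mu_N$ on $\mathbb{T}_N$ is $\mu_N\{T\}=e^{-\beta E(T)}/Z_N$, $Z_N=\sum_{T\in\mathbb{T}_N}e^{-\beta E(T)}$. For $T\in\mathbb{T}_N$, $\pi_{n,N}T$ is the subtree spanned by all vertices of height at most $n$. $S_n$ is the finite set of plane trees of height exactly $n$ with all branching numbers at most $D$. For $N$ sufficiently large, $\pi_{n,N}$ maps $\mathbb{T}_N$ into $S_n$, and $P_n$ denotes the probability measure on $S_n$ that is the limit in total variation, as $N\to\infty$, of the push-forwards $\mu_N\pi_{n,N}^{-1}$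 (this limit exists). In the claim, $P_n$ is regarded as a measure on the set of plane trees of height at most $n$, giving full mass to $S_n$. $\mathbb{T}$ is the space of all plane trees, finite or infinite, with branching numbers at most $D$. It is identified with a subset of $\mathbb{X}=\prod_{n=1}^\infty\{0,1,\ldots,D^{n-1}\}^{D^n}$ as follows: the vertices of height $n$ (the $n$-th level) are naturally ordered and enumerated by $1,\ldots,r_n$ ($r_n\le D^n$); $g_{n,l}$ is the number of the parent (in the enumeration of level $n-1$) of the $l$-th vertex of level $n$ if $1\le l\le r_n$, and $g_{n,l}=0$ if $r_n<l\le D^n$; the tree is identified with $(g_1,g_2,\ldots)$, $g_n=(g_{n,1},\ldots,g_{n,D^n})$. $\mathbb{T}$ carries the $\sigma$-algebra induced from the product $\sigma$-algebra on $\mathbb{X}$. *)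

theory Defs
  imports "HOL-Probability.Probability"
begin

text \<open>
  Locally finite plane trees, finite or infinite, up to isomorphism. Since the type is
  coinductive, two trees are equal as soon as they have the same shape at every finite height.
\<close>

codatatype plane_tree = Node (children: "plane_tree list")

text \<open>
  The list of the subtrees rooted at the vertices of height \<open>n\<close>, in the natural order.
\<close>

primrec tree_level :: "plane_tree \<Rightarrow> nat \<Rightarrow> plane_tree list" where
  "tree_level T 0 = [T]"
| "tree_level T (Suc n) = concat (map children (tree_level T n))"

definition level_size :: "plane_tree \<Rightarrow> nat \<Rightarrow> nat" where
  "level_size T n = length (tree_level T n)"

text \<open>
  A vertex is a pair \<open>(n, l)\<close>: the \<open>l\<close>-th vertex of height \<open>n\<close>, where
  \<open>l\<close> counts from 1.
\<close>

definition vertices :: "plane_tree \<Rightarrow> (nat \<times> nat) set" where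
  "vertices T = {(n, l). 1 \<le> l \<and> l \<le> level_size T n}"

definition branching :: "plane_tree \<Rightarrow> nat \<times> nat \<Rightarrow> nat" where
  "branching T v = length (children (tree_level T (fst v) ! (snd v - 1)))"

definition finite_tree :: "plane_tree \<Rightarrow> bool" where
  "finite_tree T \<longleftrightarrow> finite (vertices T)"

text \<open>Only meaningful for finite trees.\<close>

definition tree_height :: "plane_tree \<Rightarrow> nat" where
  "tree_height T = Max (fst ` vertices T)"

definition trees :: "nat \<Rightarrow> plane_tree set" where
  "trees D = {T. \<forall>v\<in>vertices T. branching T v \<le> D}"

text \<open>
  Finiteness is stated separately because \<open>card\<close> is 0 on infinite sets.
\<close>

definition trees_of_size :: "nat \<Rightarrow> nat \<Rightarrow> plane_tree set" where
  "trees_of_size D N = {T \<in> trees D. finite_tree T \<and> card (vertices T) = N}"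

definition trees_of_height :: "nat \<Rightarrow> nat \<Rightarrow> plane_tree set" where
  "trees_of_height D n = {T \<in> trees D. finite_tree T \<and> tree_height T = n}"

definition infinite_trees :: "nat \<Rightarrow> plane_tree set" where
  "infinite_trees D = {T \<in> trees D. \<not> finite_tree T}"

definition trees_height_le :: "nat \<Rightarrow> plane_tree set" where
  "trees_height_le n = {T. finite_tree T \<and> tree_height T \<le> n}"

text \<open>The subtree spanned by the vertices of height at most \<open>n\<close>.\<close>

primrec truncate_tree :: "nat \<Rightarrow> plane_tree \<Rightarrow> plane_tree" where
  "truncate_tree 0 T = Node []"
| "truncate_tree (Suc n) T = Node (map (truncate_tree n) (children T))"

definition energy :: "(nat \<Rightarrow> real) \<Rightarrow> plane_tree \<Rightarrow> real" where
  "energy E T = (\<Sum>v\<in>vertices T. E (branching T v))"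

definition partition_function :: "nat \<Rightarrow> (nat \<Rightarrow> real) \<Rightarrow> real \<Rightarrow> nat \<Rightarrow> real" where
  "partition_function D E \<beta> N = (\<Sum>T\<in>trees_of_size D N. exp (- \<beta> * energy E T))"

definition gibbs :: "nat \<Rightarrow> (nat \<Rightarrow> real) \<Rightarrow> real \<Rightarrow> nat \<Rightarrow> plane_tree measure" where
  "gibbs D E \<beta> N =
     point_measure (trees_of_size D N)
       (\<lambda>T. ennreal (exp (- \<beta> * energy E T) / partition_function D E \<beta> N))"

text \<open>Intended for probability measures on the same \<open>\<sigma>\<close>-algebra.\<close>

definition tv_dist :: "'a measure \<Rightarrow> 'a measure \<Rightarrow> real" where
  "tv_dist M M' = (SUP A\<in>sets M. \<bar>measure M A - measure M' A\<bar>)"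

text \<open>
  The limit law of the root's neighbourhood of height \<open>n\<close>. All measures live on the
  discrete space of trees of height at most \<open>n\<close>, so that the push-forward also makes
  sense for small \<open>N\<close>, where some trees on \<open>N\<close> vertices are lower than \<open>n\<close>.
\<close>

definition is_local_limit ::
    "nat \<Rightarrow> (nat \<Rightarrow> real) \<Rightarrow> real \<Rightarrow> nat \<Rightarrow> plane_tree measure \<Rightarrow> bool" where
  "is_local_limit D E \<beta> n P \<longleftrightarrow>
     prob_space P \<and> sets P = sets (count_space (trees_height_le n)) \<and>
     measure P (trees_of_height D n) = 1 \<and>
     (\<lambda>N. tv_dist (distr (gibbs D E \<beta> N) (count_space (trees_height_le n)) (truncate_tree n)) P)
       \<longlonglongrightarrow> 0"

text \<open>
  For \<open>n \<ge> 1\<close>: the list of the numbers (within level \<open>n - 1\<close>) of the parents of the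
  successive vertices of level \<open>n\<close>.
\<close>

definition parents :: "plane_tree \<Rightarrow> nat \<Rightarrow> nat list" where
  "parents T n =
     concat (map (\<lambda>i. replicate (branching T (n - 1, i)) i) [1..<Suc (level_size T (n - 1))])"

definition parent_code :: "plane_tree \<Rightarrow> nat \<Rightarrow> nat \<Rightarrow> nat" where
  "parent_code T n l = (if 1 \<le> l \<and> l \<le> level_size T n then parents T n ! (l - 1) else 0)"

definition tree_code :: "nat \<Rightarrow> plane_tree \<Rightarrow> nat \<Rightarrow> nat \<Rightarrow> nat" where
  "tree_code D T = (\<lambda>n\<in>{1..}. \<lambda>l\<in>{1..D ^ n}. parent_code T n l)"

definition code_space :: "nat \<Rightarrow> (nat \<Rightarrow> nat \<Rightarrow> nat) measure" where
  "code_space D =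
     (\<Pi>\<^sub>M n\<in>{1..}. \<Pi>\<^sub>M l\<in>{1..D ^ n}. count_space {0..D ^ (n - 1)})"

text \<open>
  Only the space and the \<open>\<sigma>\<close>-algebra of this object are relevant.
\<close>

definition tree_space :: "nat \<Rightarrow> plane_tree measure" where
  "tree_space D = vimage_algebra (trees D) (tree_code D) (code_space D)"

text \<open>
  Measurability of the truncations only depends on the \<open>\<sigma>\<close>-algebra of \<open>Q\<close>; it is
  included because \<open>distr\<close> is the push-forward only along measurable maps.
\<close>

definition consistent_with ::
    "nat \<Rightarrow> (nat \<Rightarrow> plane_tree measure) \<Rightarrow> plane_tree measure \<Rightarrow> bool" where
  "consistent_with D P Q \<longleftrightarrow>
     sets Q = sets (tree_space D) \<and>
     (\<forall>n\<ge>1. truncate_tree n \<in> Q \<rightarrow>\<^sub>M count_space (trees_height_le n) \<and>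
        distr Q (count_space (trees_height_le n)) (truncate_tree n) = P n)"

end

theory Submission
  imports Defs "HOL-Probability.Discrete_Topology"
begin

text \<open>
  For \<open>m \<le> n\<close> the truncation at height \<open>m\<close> factors through the one at height \<open>n\<close>, so passing to
  the limit in the push-forwards of the Gibbs measures shows that \<open>P m\<close> is the image of \<open>P n\<close>.
  Kolmogorov's extension theorem then gives a random sequence of finite trees that is almost surely
  coherent under truncation; gluing such a sequence to a single tree gives the measure. Since the
  parent codes of the levels up to \<open>n\<close> and the truncation at height \<open>n\<close> determine each other, the
  sets of trees with prescribed truncation form an intersection-stable generator of the
  \<open>\<sigma>\<close>-algebra, whence uniqueness. A tree is infinite iff its truncation at every height \<open>n\<close> has
  height exactly \<open>n\<close>, which is a countable intersection of events of full measure.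
\<close>

subsection \<open>Truncations of plane trees\<close>

lemma level_size_0 [simp]: "level_size T 0 = 1"
  by (simp add: level_size_def)

lemma tree_level_truncate:
  "k \<le> n \<Longrightarrow> tree_level (truncate_tree n T) k = map (truncate_tree (n - k)) (tree_level T k)"
proof (induction k)
  case (Suc k)
  then have n: "n - k = Suc (n - Suc k)"
    by simp
  have "tree_level (truncate_tree n T) (Suc k) =
      concat (map (children \<circ> truncate_tree (n - k)) (tree_level T k))"
    using Suc by simp
  also have "\<dots> = concat (map (map (truncate_tree (n - Suc k)) \<circ> children) (tree_level T k))"
    unfolding n by (simp add: comp_def)
  finally show ?case
    by (simp add: map_concat)
qed simp

lemma tree_level_truncate_eq_Nil:
  assumes "k > n"
  shows "tree_level (truncate_tree n T) k = []"
proof -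
  have "tree_level (truncate_tree n T) (Suc n + j) = []" for j
    by (induction j) (auto simp: tree_level_truncate)
  from this[of "k - Suc n"] show ?thesis
    using assms by simp
qed

lemma level_size_truncate:
  "level_size (truncate_tree n T) k = (if k \<le> n then level_size T k else 0)"
  by (simp add: level_size_def tree_level_truncate tree_level_truncate_eq_Nil)

lemma vertices_truncate: "vertices (truncate_tree n T) = {v \<in> vertices T. fst v \<le> n}"
  by (auto simp: vertices_def level_size_truncate split: if_splits)

lemma branching_truncate:
  assumes "v \<in> vertices T" "fst v < n"
  shows "branching (truncate_tree n T) v = branching T v"
proof -
  have n: "n - fst v = Suc (n - Suc (fst v))"
    using assms by simp
  have "snd v - 1 < length (tree_level T (fst v))"
    using assms by (auto simp: vertices_def level_size_def)
  then show ?thesis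
    using assms unfolding branching_def by (simp add: tree_level_truncate n)
qed

text \<open>The vertices of height \<open>n\<close> become leaves, hence the strict inequality in
  \<open>branching_truncate\<close>.\<close>

lemma branching_truncate_top:
  assumes "v \<in> vertices T" "fst v = n"
  shows "branching (truncate_tree n T) v = 0"
proof -
  have "snd v - 1 < length (tree_level T (fst v))"
    using assms by (auto simp: vertices_def level_size_def)
  then show ?thesis
    using assms unfolding branching_def by (simp add: tree_level_truncate)
qed

lemma truncate_truncate:
  "truncate_tree m (truncate_tree n T) = truncate_tree (min m n) T"
proof (induction m arbitrary: n T)
  case (Suc m)
  then show ?case by (cases n) auto
qed simp

lemma truncate_in_trees:
  assumes "T \<in> trees D"
  shows "truncate_tree n T \<in> trees D"
proof -
  have "branching (truncate_tree n T) v \<le> D" if "v \<in> vertices T" "fst v \<le> n" for v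
    using that assms branching_truncate[of v T n] branching_truncate_top[of v T n]
    by (cases "fst v = n") (auto simp: trees_def)
  then show ?thesis
    by (auto simp: trees_def vertices_truncate)
qed

text \<open>A cut turns the vertices at its own height into leaves, so the branching number of
  \<open>v\<close> is read off the truncation one level above the height of
  \<open>v\<close>.\<close>

lemma treesI_truncate:
  assumes "\<And>n. n \<ge> 1 \<Longrightarrow> truncate_tree n T \<in> trees D"
  shows "T \<in> trees D"
proof -
  have "branching T v \<le> D" if "v \<in> vertices T" for v
  proof -
    have "v \<in> vertices (truncate_tree (Suc (fst v)) T)"
      using that by (simp add: vertices_truncate del: truncate_tree.simps)
    then have "branching (truncate_tree (Suc (fst v)) T) v \<le> D"
      using assms[of "Suc (fst v)"] by (auto simp: trees_def simp del: truncate_tree.simps)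
    then show ?thesis
      using that by (simp add: branching_truncate del: truncate_tree.simps)
  qed
  then show ?thesis
    by (auto simp: trees_def)
qed

section \<open>Empty levels, finiteness and height\<close>

lemma level_size_Suc_eq_0: "level_size T n = 0 \<Longrightarrow> level_size T (Suc n) = 0"
  by (simp add: level_size_def)

lemma level_size_antimono_0:
  assumes "level_size T m = 0" "m \<le> n"
  shows "level_size T n = 0"
  using assms(2,1) by (induction rule: dec_induct) (auto intro: level_size_Suc_eq_0)

lemma vertices_eq_Sigma: "vertices T = (SIGMA n:UNIV. {1..level_size T n})"
  by (auto simp: vertices_def)

lemma fst_vertices: "fst ` vertices T = {n. level_size T n > 0}"
  by (force simp: vertices_eq_Sigma image_iff)

text \<open>Levels are finite and all levels after an empty one are empty, so an infinite vertex set
  meets every level.\<close>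

lemma finite_tree_iff: "finite_tree T \<longleftrightarrow> (\<exists>n. level_size T n = 0)"
proof
  assume "finite_tree T"
  then have "finite {n. level_size T n > 0}"
    unfolding finite_tree_def fst_vertices[symmetric] by simp
  then show "\<exists>n. level_size T n = 0"
    using ex_new_if_finite[of "{n. level_size T n > 0}"] by auto
next
  assume "\<exists>n. level_size T n = 0"
  then obtain n where "level_size T n = 0" ..
  then have "level_size T k = 0" if "k > n" for k
    using that by (intro level_size_antimono_0[of T n k]) auto
  then have "vertices T \<subseteq> (SIGMA k:{..n}. {1..level_size T k})"
    by (auto simp: vertices_eq_Sigma not_le) (metis not_le not_one_le_zero order_trans One_nat_def)
  then show "finite_tree T"
    unfolding finite_tree_def by (rule finite_subset) auto
qed

lemma finite_tree_truncate: "finite_tree (truncate_tree n T)"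
  unfolding finite_tree_iff by (rule exI[of _ "Suc n"]) (simp add: level_size_truncate)

lemma tree_height_truncate_le: "tree_height (truncate_tree n T) \<le> n"
proof -
  have "0 \<in> fst ` vertices (truncate_tree n T)"
    by (simp add: fst_vertices level_size_truncate)
  moreover have "finite (fst ` vertices (truncate_tree n T))"
    using finite_tree_truncate[of n T] by (simp add: finite_tree_def)
  ultimately show ?thesis
    unfolding tree_height_def by (subst Max_le_iff) (auto simp: vertices_truncate)
qed

lemma truncate_in_trees_height_le: "truncate_tree n T \<in> trees_height_le n"
  by (simp add: trees_height_le_def finite_tree_truncate tree_height_truncate_le)

lemma tree_height_truncate_eq_iff:
  "tree_height (truncate_tree n T) = n \<longleftrightarrow> level_size T n > 0"
proof -
  let ?S = "fst ` vertices (truncate_tree n T)"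
  have S: "?S = {k. k \<le> n \<and> level_size T k > 0}"
    by (auto simp: fst_vertices level_size_truncate)
  have fin: "finite ?S" and ne: "?S \<noteq> {}"
    unfolding S by (auto intro: exI[of _ 0])
  have "Max ?S \<in> ?S"
    by (rule Max_in[OF fin ne])
  moreover have "Max ?S = n" if "n \<in> ?S"
    using that fin by (intro Max_eqI) (auto simp: S)
  ultimately show ?thesis
    unfolding tree_height_def using S by auto
qed

text \<open>Expresses infiniteness through events that the measures \<open>P n\<close> control: no
  level is empty, and level \<open>n\<close> is nonempty iff the truncation at \<open>n\<close> has
  height exactly \<open>n\<close>. The root always occupies level 0, so the heights from 1 on
  suffice.\<close>

lemma infinite_trees_iff:
  "T \<in> infinite_trees D \<longleftrightarrow> (\<forall>n\<ge>1. truncate_tree n T \<in> trees_of_height D n)"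
proof -
  have "T \<in> trees D \<longleftrightarrow> (\<forall>n\<ge>1. truncate_tree n T \<in> trees D)"
    using treesI_truncate truncate_in_trees by blast
  moreover have "\<not> finite_tree T \<longleftrightarrow> (\<forall>n\<ge>1. level_size T n > 0)"
    unfolding finite_tree_iff
    by (metis gr0I level_size_0 less_one not_le zero_less_one nat_neq_iff)
  ultimately show ?thesis
    by (auto simp: infinite_trees_def trees_of_height_def finite_tree_truncate
        tree_height_truncate_eq_iff)
qed

lemma trees_of_height_subset: "trees_of_height D n \<subseteq> trees_height_le n"
  by (auto simp: trees_of_height_def trees_height_le_def)


section \<open>Levels and parent codes\<close>

lemma branchings_eq:
  "map (\<lambda>i. branching T (n, i)) [1..<Suc (level_size T n)] = map (length \<circ> children) (tree_level T n)"
  by (rule nth_equalityI) (auto simp: branching_def level_size_def simp del: upt_Suc)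

lemma level_size_Suc:
  "level_size T (Suc n) = (\<Sum>i=1..level_size T n. branching T (n, i))"
proof -
  have "level_size T (Suc n) = sum_list (map (length \<circ> children) (tree_level T n))"
    by (simp add: level_size_def length_concat)
  also have "\<dots> = (\<Sum>i\<leftarrow>[1..<Suc (level_size T n)]. branching T (n, i))"
    by (simp only: branchings_eq)
  finally show ?thesis
    by (simp add: interv_sum_list_conv_sum_set_nat atLeastLessThanSuc_atLeastAtMost del: upt_Suc)
qed

lemma length_parents: "length (parents T (Suc n)) = level_size T (Suc n)"
  by (simp add: parents_def length_concat comp_def level_size_Suc interv_sum_list_conv_sum_set_nat
      atLeastLessThanSuc_atLeastAtMost del: upt_Suc)

lemma set_parents: "set (parents T (Suc n)) \<subseteq> {1..level_size T n}"
  by (auto simp: parents_def simp del: upt_Suc)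

text \<open>Each \<open>j\<close> contributes one block of copies of itself, and by distinctness
  only one block contains \<open>i\<close>. This recovers branching numbers from
  \<open>parents\<close>.\<close>

lemma count_list_concat_map_replicate:
  "distinct xs \<Longrightarrow> i \<in> set xs \<Longrightarrow> count_list (concat (map (\<lambda>j. replicate (f j) j) xs)) i = f i"
proof (induction xs)
  case (Cons x xs)
  have "count_list (replicate k x) i = (if i = x then k else 0)" for k
    by (induction k) auto
  moreover have "count_list (concat (map (\<lambda>j. replicate (f j) j) xs)) x = 0" if "x \<notin> set xs"
    using that by (intro count_notin) auto
  ultimately show ?case
    using Cons by (auto simp: count_list_append)
qed simp

lemma branching_eq_count:
  "1 \<le> i \<Longrightarrow> i \<le> level_size T n \<Longrightarrow> branching T (n, i) = count_list (parents T (Suc n)) i"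
  unfolding parents_def
  by (subst count_list_concat_map_replicate) (auto simp del: upt_Suc)

lemma level_size_le:
  assumes "T \<in> trees D"
  shows "level_size T n \<le> D ^ n"
proof (induction n)
  case (Suc n)
  have "level_size T (Suc n) \<le> (\<Sum>i=1..level_size T n. D)"
    unfolding level_size_Suc using assms
    by (intro sum_mono) (auto simp: trees_def vertices_def)
  also have "\<dots> \<le> D ^ Suc n"
    using Suc by (simp add: mult.commute)
  finally show ?case .
qed simp

lemma parent_code_pos:
  assumes "1 \<le> l" "l \<le> level_size T (Suc n)"
  shows "parent_code T (Suc n) l \<in> {1..level_size T n}"
proof -
  have "parents T (Suc n) ! (l - 1) \<in> set (parents T (Suc n))"
    using assms by (intro nth_mem) (simp add: length_parents)
  then show ?thesis
    using assms set_parents[of T n] by (auto simp: parent_code_def)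
qed

lemma parent_code_le:
  assumes "T \<in> trees D"
  shows "parent_code T (Suc n) l \<le> D ^ n"
  using parent_code_pos[of l T n] level_size_le[OF assms, of n]
  by (cases "1 \<le> l \<and> l \<le> level_size T (Suc n)") (auto simp: parent_code_def)

lemma parents_eq_map_parent_code:
  "parents T (Suc n) = map (parent_code T (Suc n)) [1..<Suc (level_size T (Suc n))]"
  by (rule nth_equalityI) (auto simp: length_parents parent_code_def simp del: upt_Suc)

text \<open>Parent numbers start at 1 and the padding is 0, so the nonzero entries mark exactly the
  vertices; by \<open>level_size_le\<close> all of them fit into the \<open>D ^ Suc n\<close>
  slots.\<close>

lemma level_size_eq_card:
  assumes "T \<in> trees D"
  shows "level_size T (Suc n) = card {l \<in> {1..D ^ Suc n}. parent_code T (Suc n) l \<noteq> 0}"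
proof -
  have "{l \<in> {1..D ^ Suc n}. parent_code T (Suc n) l \<noteq> 0} = {1..level_size T (Suc n)}"
    using level_size_le[OF assms, of "Suc n"] parent_code_pos[of _ T n]
    by (fastforce simp: parent_code_def split: if_splits)
  then show ?thesis
    by simp
qed

text \<open>The parent list of level \<open>n\<close> is built from the branching numbers of level
  \<open>n - 1\<close>, which a cut at height \<open>n\<close> leaves unchanged.\<close>

lemma parent_code_truncate:
  assumes "n \<ge> 1"
  shows "parent_code (truncate_tree n T) n = parent_code T n"
proof -
  have "branching (truncate_tree n T) (n - 1, i) = branching T (n - 1, i)"
    if "1 \<le> i" "i \<le> level_size T (n - 1)" for i
    using that assms by (intro branching_truncate) (auto simp: vertices_def)
  then have "parents (truncate_tree n T) n = parents T n"
    unfolding parents_def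
    by (auto simp: level_size_truncate simp del: upt_Suc intro!: arg_cong[where f = concat])
  then show ?thesis
    by (auto simp: parent_code_def level_size_truncate fun_eq_iff)
qed

text \<open>The induction runs over forests, since removing the root of a tree leaves a forest;
  \<open>lev k\<close> is the \<open>k\<close>-th level of a forest. The branching numbers of the
  levels before \<open>n\<close>, read in order, determine the forest up to height
  \<open>n\<close>.\<close>

lemma map_truncate_eqI:
  fixes ts ts' :: "plane_tree list"
  defines "lev \<equiv> \<lambda>k. (\<lambda>ts. concat (map children ts)) ^^ k"
  assumes "length ts = length ts'"
    and "\<And>k. k < n \<Longrightarrow> map (length \<circ> children) (lev k ts) = map (length \<circ> children) (lev k ts')"
  shows "map (truncate_tree n) ts = map (truncate_tree n) ts'"
  using assms(2,3)
proof (induction n arbitrary: ts ts')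
  case 0
  then show ?case
    by (simp add: map_replicate_const cong: map_cong)
next
  case (Suc n)
  let ?f = "\<lambda>ts. concat (map children ts)"
  have deg: "map (length \<circ> children) ts = map (length \<circ> children) ts'"
    using Suc.prems(2)[of 0] by (simp add: lev_def comp_def)
  \<comment> \<open>The levels of the forest of children are the old levels shifted by one, so the
    induction hypothesis applies to it.\<close>
  have "map (truncate_tree n) (?f ts) = map (truncate_tree n) (?f ts')"
  proof (rule Suc.IH)
    show "length (?f ts) = length (?f ts')"
      using deg by (simp add: length_concat comp_def)
    show "map (length \<circ> children) (lev k (?f ts)) = map (length \<circ> children) (lev k (?f ts'))"
      if "k < n" for k
    proof -
      have "lev (Suc k) us = lev k (?f us)" for us
        by (simp only: lev_def funpow_Suc_right comp_apply)
      then show ?thesis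
        using Suc.prems(2)[of "Suc k"] that by (simp add: comp_def)
    qed
  qed
  then have eq: "concat (map (map (truncate_tree n) \<circ> children) ts) =
      concat (map (map (truncate_tree n) \<circ> children) ts')"
    by (simp add: map_concat)
  \<comment> \<open>Equal branching numbers make corresponding blocks of the two concatenations
    equally long, so these split back into the lists of children.\<close>
  have "map (map (truncate_tree n) \<circ> children) ts = map (map (truncate_tree n) \<circ> children) ts'"
  proof (rule concat_injective[OF eq])
    have "length (children (ts ! i)) = length (children (ts' ! i))" if "i < length ts" for i
      using arg_cong[OF deg, of "\<lambda>xs. xs ! i"] that Suc.prems(1) by simp
    then show "\<forall>(x, y)\<in>set (zip (map (map (truncate_tree n) \<circ> children) ts)
        (map (map (truncate_tree n) \<circ> children) ts')). length x = length y"
      by (auto simp: set_zip)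
  qed (use Suc.prems in simp)
  then have "map Node (map (map (truncate_tree n) \<circ> children) ts) =
      map Node (map (map (truncate_tree n) \<circ> children) ts')"
    by simp
  then show ?case
    by (simp add: comp_def)
qed

lemma tree_level_eq_funpow: "tree_level T n = ((\<lambda>ts. concat (map children ts)) ^^ n) [T]"
  by (induction n) auto

text \<open>
  The nonzero codes of level \<open>k\<close> count the vertices of that level, and the multiplicities
  of the codes are the branching numbers one level below.
\<close>

lemma truncate_tree_eqI:
  assumes T: "T \<in> trees D" and T': "T' \<in> trees D"
    and code: "\<And>k l. k \<in> {1..n} \<Longrightarrow> l \<in> {1..D ^ k} \<Longrightarrow> parent_code T k l = parent_code T' k l"
  shows "truncate_tree n T = truncate_tree n T'"
proof -
  have size: "level_size T k = level_size T' k" if "k \<le> n" for k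
  proof (cases k)
    case (Suc j)
    have "{l \<in> {1..D ^ Suc j}. parent_code T (Suc j) l \<noteq> 0} =
        {l \<in> {1..D ^ Suc j}. parent_code T' (Suc j) l \<noteq> 0}"
      using code[of "Suc j"] Suc that by auto
    then show ?thesis
      unfolding Suc level_size_eq_card[OF T] level_size_eq_card[OF T'] by simp
  qed simp
  have parents: "parents T (Suc k) = parents T' (Suc k)" if "k < n" for k
    unfolding parents_eq_map_parent_code using size[of "Suc k"] level_size_le[OF T, of "Suc k"] that
    by (auto simp del: upt_Suc power_Suc intro!: code)
  have "map (length \<circ> children) (tree_level T k) = map (length \<circ> children) (tree_level T' k)"
    if "k < n" for k
    unfolding branchings_eq[symmetric] using size[of k] parents[OF that] that
    by (auto simp: branching_eq_count simp del: upt_Suc)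
  then have "map (truncate_tree n) [T] = map (truncate_tree n) [T']"
    by (intro map_truncate_eqI) (auto simp: tree_level_eq_funpow)
  then show ?thesis
    by simp
qed

section \<open>Gluing a coherent sequence of trees\<close>

primcorec limit_tree :: "(nat \<Rightarrow> plane_tree) \<Rightarrow> plane_tree" where
  "limit_tree t = Node (map (\<lambda>i. limit_tree (\<lambda>n. children (t (Suc n)) ! i))
     [0..<length (children (t 1))])"

text \<open>Induction on \<open>n\<close> for all \<open>t\<close> at once: the \<open>i\<close>-th
  children of \<open>t 1\<close>, \<open>t 2\<close>, ... are again coherent, and
  \<open>limit_tree\<close> glues them to the \<open>i\<close>-th subtree. Coherence makes
  \<open>t 0\<close> a single vertex, so \<open>t 1\<close> is the first tree that shows the
  children of the root.\<close>

lemma truncate_limit_tree: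
  assumes "\<And>n. truncate_tree n (t (Suc n)) = t n"
  shows "truncate_tree n (limit_tree t) = t n"
  using assms
proof (induction n arbitrary: t)
  case 0
  from 0[of 0] show ?case
    by simp
next
  case (Suc n)
  have coh: "map (truncate_tree k) (children (t (Suc (Suc k)))) = children (t (Suc k))" for k
    using Suc.prems[of "Suc k"] by (metis plane_tree.sel truncate_tree.simps(2))
  \<comment> \<open>The root has equally many children in every \<open>t (Suc k)\<close>, so the
    index \<open>i\<close> below is valid in all the lists.\<close>
  have len: "length (children (t (Suc k))) = length (children (t 1))" for k
    using coh by (induction k) (auto, metis length_map)
  have "truncate_tree n (limit_tree (\<lambda>k. children (t (Suc k)) ! i)) = children (t (Suc n)) ! i"
    if "i < length (children (t 1))" for i
  proof (rule Suc.IH)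
    show "truncate_tree k (children (t (Suc (Suc k))) ! i) = children (t (Suc k)) ! i" for k
      using arg_cong[OF coh[of k], of "\<lambda>xs. xs ! i"] that len[of "Suc k"] by simp
  qed
  then have "truncate_tree (Suc n) (limit_tree t) =
      Node (map (\<lambda>i. children (t (Suc n)) ! i) [0..<length (children (t 1))])"
    by (subst limit_tree.code) simp
  also have "\<dots> = t (Suc n)"
    using len[of n] map_nth[of "children (t (Suc n))"] by simp
  finally show ?case .
qed

subsection \<open>The measurable space of trees\<close>

text \<open>A tree cut at height \<open>Suc n\<close> is a finite list of trees cut at height
  \<open>n\<close>, so countability passes on without any degree bound. Measurability of a
  truncation can therefore be tested on single trees.\<close>

lemma countable_range_truncate: "countable (range (truncate_tree n))"
proof (induction n)
  case (Suc n)
  have "map (truncate_tree n) (children T) \<in> lists (range (truncate_tree n))" for T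
    by auto
  then have "range (truncate_tree (Suc n)) \<subseteq> Node ` lists (range (truncate_tree n))"
    by (auto simp del: in_lists_conv_set)
  then show ?case
    by (rule countable_subset) (intro Suc countable_image countable_lists)
qed simp

lemma space_tree_space: "space (tree_space D) = trees D"
  by (simp add: tree_space_def)

lemma tree_code_in_space:
  assumes "T \<in> trees D"
  shows "tree_code D T \<in> space (code_space D)"
proof -
  have "parent_code T n l \<le> D ^ (n - 1)" if "n \<ge> 1" for n l
    using that parent_code_le[OF assms, of "n - 1" l] by simp
  then show ?thesis
    by (auto simp: tree_code_def code_space_def space_PiM)
qed

lemma measurable_parent_code:
  assumes "n \<ge> 1" "l \<in> {1..D ^ n}"
  shows "(\<lambda>T. parent_code T n l) \<in> tree_space D \<rightarrow>\<^sub>M count_space {0..D ^ (n - 1)}"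
proof -
  have "tree_code D \<in> tree_space D \<rightarrow>\<^sub>M code_space D"
    unfolding tree_space_def by (rule measurable_vimage_algebra1) (auto intro: tree_code_in_space)
  moreover have "(\<lambda>x. x n) \<in> code_space D \<rightarrow>\<^sub>M (\<Pi>\<^sub>M l\<in>{1..D ^ n}. count_space {0..D ^ (n - 1)})"
    unfolding code_space_def by (rule measurable_component_singleton) (use assms in simp)
  moreover have "(\<lambda>x. x l) \<in>
      (\<Pi>\<^sub>M l\<in>{1..D ^ n}. count_space {0..D ^ (n - 1)}) \<rightarrow>\<^sub>M count_space {0..D ^ (n - 1)}"
    by (rule measurable_component_singleton) (use assms in simp)
  ultimately have "(\<lambda>T. tree_code D T n l) \<in> tree_space D \<rightarrow>\<^sub>M count_space {0..D ^ (n - 1)}"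
    by (intro measurable_compose[where f = "\<lambda>T. tree_code D T n" and g = "\<lambda>x. x l"]
        measurable_compose[where f = "tree_code D" and g = "\<lambda>x. x n"])
  then show ?thesis
    using assms by (simp add: tree_code_def)
qed

text \<open>A nonempty fibre, over the truncation of some \<open>T0\<close>, is cut out by finitely
  many equations between parent codes: \<open>parent_code_truncate\<close> gives one inclusion and
  \<open>truncate_tree_eqI\<close> the other.\<close>

lemma measurable_truncate: "truncate_tree n \<in> tree_space D \<rightarrow>\<^sub>M count_space (trees_height_le n)"
proof -
  have "truncate_tree n -` {S} \<inter> space (tree_space D) \<in> sets (tree_space D)" for S
  proof (cases "\<exists>T0\<in>trees D. truncate_tree n T0 = S")
    case True
    then obtain T0 where T0: "T0 \<in> trees D" "truncate_tree n T0 = S"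
      by auto
    have code: "parent_code T k l = parent_code T0 k l"
      if "truncate_tree n T = S" "k \<in> {1..n}" for T k l
    proof -
      have "truncate_tree k T = truncate_tree k T0"
        using that T0 truncate_truncate[of k n T] truncate_truncate[of k n T0] by simp
      then show ?thesis
        using parent_code_truncate[of k T] parent_code_truncate[of k T0] that by simp
    qed
    have "truncate_tree n -` {S} \<inter> space (tree_space D) =
        {T \<in> space (tree_space D). \<forall>k\<in>{1..n}. \<forall>l\<in>{1..D ^ k}. parent_code T k l = parent_code T0 k l}"
    proof (intro set_eqI iffI)
      fix T assume "T \<in> {T \<in> space (tree_space D). \<forall>k\<in>{1..n}. \<forall>l\<in>{1..D ^ k}.
        parent_code T k l = parent_code T0 k l}"
      then have "T \<in> trees D" "truncate_tree n T = truncate_tree n T0"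
        by (auto simp: space_tree_space intro!: truncate_tree_eqI[of T D T0 n] T0(1))
      with T0 show "T \<in> truncate_tree n -` {S} \<inter> space (tree_space D)"
        by (simp add: space_tree_space)
    next
      fix T assume "T \<in> truncate_tree n -` {S} \<inter> space (tree_space D)"
      then show "T \<in> {T \<in> space (tree_space D). \<forall>k\<in>{1..n}. \<forall>l\<in>{1..D ^ k}.
        parent_code T k l = parent_code T0 k l}"
        using code[of T] by simp
    qed
    also have "\<dots> \<in> sets (tree_space D)"
    proof (intro sets.sets_Collect_finite_All)
      fix k l assume "k \<in> {1..n}" "l \<in> {1..D ^ k}"
      then have "(\<lambda>T. parent_code T k l) \<in> tree_space D \<rightarrow>\<^sub>M count_space {0..D ^ (k - 1)}"
        by (intro measurable_parent_code) auto
      then have "(\<lambda>T. parent_code T k l) \<in> tree_space D \<rightarrow>\<^sub>M count_space UNIV"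
        by (rule measurable_compose) simp
      from measurable_sets[OF this, of "{parent_code T0 k l}"]
      show "{T \<in> space (tree_space D). parent_code T k l = parent_code T0 k l} \<in> sets (tree_space D)"
        by (simp add: vimage_def Int_def conj_commute)
    qed auto
    finally show ?thesis .
  next
    case False
    then have "truncate_tree n -` {S} \<inter> space (tree_space D) = {}"
      by (auto simp: space_tree_space)
    then show ?thesis
      by simp
  qed
  then have "truncate_tree n \<in> tree_space D \<rightarrow>\<^sub>M count_space (range (truncate_tree n))"
    by (subst measurable_count_space_eq_countable[OF countable_range_truncate]) auto
  then show ?thesis
    by (rule measurable_compose) (auto simp: truncate_in_trees_height_le)
qed

text \<open>The codes of level \<open>n\<close> are functions of the truncation at height
  \<open>n\<close>, which is a discrete variable, so they inherit its measurability.\<close>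

lemma measurable_tree_spaceI:
  assumes trees: "\<And>x. x \<in> space M \<Longrightarrow> f x \<in> trees D"
    and trunc: "\<And>n. n \<ge> 1 \<Longrightarrow> (\<lambda>x. truncate_tree n (f x)) \<in> M \<rightarrow>\<^sub>M count_space UNIV"
  shows "f \<in> M \<rightarrow>\<^sub>M tree_space D"
proof -
  have code: "(\<lambda>x. parent_code (f x) n l) \<in> M \<rightarrow>\<^sub>M count_space {0..D ^ (n - 1)}"
    if n: "n \<ge> 1" and "l \<in> {1..D ^ n}" for n l
  proof -
    have "(\<lambda>x. parent_code (truncate_tree n (f x)) n l) \<in> M \<rightarrow>\<^sub>M count_space UNIV"
      by (rule measurable_compose[OF trunc[OF n]]) simp
    then have *: "(\<lambda>x. parent_code (f x) n l) \<in> M \<rightarrow>\<^sub>M count_space UNIV"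
      using n by (simp add: parent_code_truncate)
    have "parent_code (f x) n l \<le> D ^ (n - 1)" if "x \<in> space M" for x
      using parent_code_le[OF trees[OF that], of "n - 1" l] n by simp
    then show ?thesis
      using measurable_sets[OF *] by (intro measurableI) auto
  qed
  have "(\<lambda>x. tree_code D (f x)) \<in> M \<rightarrow>\<^sub>M code_space D"
    unfolding code_space_def tree_code_def
    by (intro measurable_restrict code) auto
  then show ?thesis
    unfolding tree_space_def using trees by (intro measurable_vimage_algebra2) auto
qed

section \<open>Cylinder sets as generator\<close>

definition cylinders :: "nat \<Rightarrow> plane_tree set set" where
  "cylinders D = {truncate_tree n -` A \<inter> trees D | n A. n \<ge> 1}"

lemma cylinder_in_sets: "truncate_tree n -` A \<inter> trees D \<in> sets (tree_space D)"
  using measurable_sets[OF measurable_truncate[of n D], of "A \<inter> trees_height_le n"]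
  by (simp add: space_tree_space truncate_in_trees_height_le vimage_def)

lemma sets_tree_space: "sets (tree_space D) = sigma_sets (trees D) (cylinders D)"
proof
  have cyl: "cylinders D \<subseteq> Pow (trees D)"
    by (auto simp: cylinders_def)
  \<comment> \<open>Measurability of the identity is the inclusion of the \<sigma>-algebras. Only
    the truncations have to be checked, and their preimages are cylinders by definition.\<close>
  have "(\<lambda>T. T) \<in> sigma (trees D) (cylinders D) \<rightarrow>\<^sub>M tree_space D"
  proof (rule measurable_tree_spaceI)
    fix n :: nat assume "n \<ge> 1"
    then show "truncate_tree n \<in> sigma (trees D) (cylinders D) \<rightarrow>\<^sub>M count_space UNIV"
      using cyl by (intro measurableI) (auto simp: cylinders_def intro!: sigma_sets.Basic)
  qed (use cyl in simp)
  from measurable_sets[OF this] show "sets (tree_space D) \<subseteq> sigma_sets (trees D) (cylinders D)"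
    using cyl sets.sets_into_space[of _ "tree_space D"]
    by (auto simp: space_tree_space Int_absorb2)
  show "sigma_sets (trees D) (cylinders D) \<subseteq> sets (tree_space D)"
    unfolding space_tree_space[symmetric]
    by (rule sets.sigma_sets_subset) (auto simp: cylinders_def space_tree_space cylinder_in_sets)
qed

text \<open>Conditions at heights \<open>m\<close> and \<open>n\<close> combine to one condition at
  height \<open>max m n\<close>, because the set \<open>A\<close> in a cylinder is
  arbitrary.\<close>

lemma Int_stable_cylinders: "Int_stable (cylinders D)"
proof (rule Int_stableI)
  fix X Y assume "X \<in> cylinders D" "Y \<in> cylinders D"
  then obtain m A n B where m: "m \<ge> 1" "X = truncate_tree m -` A \<inter> trees D"
    and n: "n \<ge> 1" "Y = truncate_tree n -` B \<inter> trees D"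
    by (auto simp: cylinders_def)
  have "X \<inter> Y = truncate_tree (max m n) -` (truncate_tree m -` A \<inter> truncate_tree n -` B) \<inter> trees D"
    by (auto simp: m n truncate_truncate)
  moreover have "max m n \<ge> 1"
    using m by simp
  ultimately show "X \<inter> Y \<in> cylinders D"
    unfolding cylinders_def by blast
qed

lemma infinite_trees_in_sets: "infinite_trees D \<in> sets (tree_space D)"
proof -
  have "infinite_trees D = (\<Inter>n\<in>{1..}. truncate_tree n -` trees_of_height D n \<inter> trees D)"
    using infinite_trees_iff[of _ D] by (auto simp: infinite_trees_def[of D])
  also have "\<dots> \<in> sets (tree_space D)"
    by (intro sets.countable_INT' countableI_type) (auto intro: cylinder_in_sets)
  finally show ?thesis .
qed

section \<open>Uniqueness, and concentration on infinite trees\<close>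

lemma consistent_emeasure_cylinder:
  assumes "consistent_with D P Q" "n \<ge> 1"
  shows "emeasure Q (truncate_tree n -` A \<inter> trees D) = emeasure (P n) (A \<inter> trees_height_le n)"
proof -
  have "sets Q = sets (tree_space D)"
    using assms by (simp add: consistent_with_def)
  then have space: "space Q = trees D"
    by (metis sets_eq_imp_space_eq space_tree_space)
  have "emeasure (P n) (A \<inter> trees_height_le n) =
      emeasure (distr Q (count_space (trees_height_le n)) (truncate_tree n)) (A \<inter> trees_height_le n)"
    using assms by (simp add: consistent_with_def)
  also have "\<dots> = emeasure Q (truncate_tree n -` A \<inter> trees D)"
    using assms by (subst emeasure_distr)
      (auto simp: consistent_with_def space truncate_in_trees_height_le intro!: arg_cong[where f = "emeasure Q"])
  finally show ?thesis ..
qed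

text \<open>A push-forward keeps the total mass. Hence uniqueness holds among all consistent
  measures, not only among probability measures.\<close>

lemma consistent_prob_space:
  assumes "consistent_with D P Q" "prob_space (P 1)"
  shows "prob_space Q"
proof -
  have "truncate_tree 1 \<in> Q \<rightarrow>\<^sub>M count_space (trees_height_le 1)"
    and "distr Q (count_space (trees_height_le 1)) (truncate_tree 1) = P 1"
    using assms(1) unfolding consistent_with_def by blast+
  with assms(2) show ?thesis
    using prob_space_distrD by metis
qed

lemma consistent_unique:
  assumes Q: "consistent_with D P Q" and Q': "consistent_with D P Q'" and "prob_space (P 1)"
  shows "Q = Q'"
proof (rule measure_eqI_generator_eq[OF Int_stable_cylinders])
  interpret prob_space Q
    by (rule consistent_prob_space) fact+
  show "cylinders D \<subseteq> Pow (trees D)"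
    by (auto simp: cylinders_def)
  show "emeasure Q X = emeasure Q' X" if "X \<in> cylinders D" for X
    using that by (auto simp: cylinders_def consistent_emeasure_cylinder[OF Q]
        consistent_emeasure_cylinder[OF Q'])
  show "sets Q = sigma_sets (trees D) (cylinders D)" "sets Q' = sigma_sets (trees D) (cylinders D)"
    using Q Q' by (auto simp: consistent_with_def sets_tree_space)
  \<comment> \<open>The whole space is a cylinder, so the constant sequence serves as the
    exhaustion.\<close>
  show "range (\<lambda>_::nat. trees D) \<subseteq> cylinders D"
    by (auto simp: cylinders_def intro!: exI[of _ 1] exI[of _ UNIV])
  show "emeasure Q (trees D) \<noteq> \<infinity>"
    by simp
qed simp

lemma consistent_infinite_trees:
  assumes Q: "consistent_with D P Q"
    and P: "\<And>n. n \<ge> 1 \<Longrightarrow> prob_space (P n)" "\<And>n. n \<ge> 1 \<Longrightarrow> measure (P n) (trees_of_height D n) = 1"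
  shows "measure Q (infinite_trees D) = 1"
proof -
  interpret prob_space Q
    by (rule consistent_prob_space[OF Q P(1)]) simp
  have sets: "sets Q = sets (tree_space D)"
    using Q by (simp add: consistent_with_def)
  then have space: "space Q = trees D"
    by (metis sets_eq_imp_space_eq space_tree_space)
  have "AE T in Q. truncate_tree n T \<in> trees_of_height D n" if "n \<ge> 1" for n
  proof -
    have "measure Q (truncate_tree n -` trees_of_height D n \<inter> trees D) = 1"
      using P(2)[OF that] consistent_emeasure_cylinder[OF Q that, of "trees_of_height D n"]
      by (simp add: measure_def Int_absorb2 trees_of_height_subset)
    then have "AE T in Q. T \<in> truncate_tree n -` trees_of_height D n \<inter> trees D"
      by (subst (asm) prob_eq_1) (simp_all add: sets cylinder_in_sets)
    then show ?thesis
      by auto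
  qed
  then have "AE T in Q. \<forall>n\<in>{1..}. truncate_tree n T \<in> trees_of_height D n"
    by (subst AE_ball_countable) auto
  then have "AE T in Q. T \<in> infinite_trees D"
    by eventually_elim (auto simp: infinite_trees_iff)
  then show ?thesis
    by (subst prob_eq_1) (simp_all add: sets infinite_trees_in_sets)
qed

subsection \<open>Consistency of the local limits\<close>

text \<open>The case split replaces a proof that there are finitely many trees of a given size: over
  an infinite set the sum defining the partition function is 0 by convention, division by it gives
  0, and the measure vanishes.\<close>

lemma finite_measure_gibbs: "finite_measure (gibbs D E \<beta> N)"
proof (cases "finite (trees_of_size D N)")
  case True
  then show ?thesis
    unfolding gibbs_def
    by (intro finite_measureI) (simp add: space_point_measure emeasure_point_measure_finite)
next
  case False
  then have "partition_function D E \<beta> N = 0"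
    by (simp add: partition_function_def)
  then have "emeasure (gibbs D E \<beta> N) (space (gibbs D E \<beta> N)) = 0"
    unfolding gibbs_def by (simp add: point_measure_def emeasure_density)
  then show ?thesis
    by (intro finite_measureI) simp
qed

lemma measurable_truncate_gibbs:
  "truncate_tree n \<in> gibbs D E \<beta> N \<rightarrow>\<^sub>M count_space (trees_height_le n)"
  unfolding gibbs_def by (simp add: measurable_point_measure_eq1 truncate_in_trees_height_le)

text \<open>A real supremum bounds its members only when the family is bounded above; the finite
  total masses ensure this.\<close>

lemma tv_dist_bound:
  assumes "finite_measure M" "finite_measure M'" "A \<in> sets M"
  shows "\<bar>measure M A - measure M' A\<bar> \<le> tv_dist M M'"
  unfolding tv_dist_def
proof (rule cSUP_upper[OF assms(3)])
  have "\<bar>measure M B - measure M' B\<bar> \<le> measure M (space M) + measure M' (space M')" for B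
    using finite_measure.bounded_measure[OF assms(1), of B] finite_measure.bounded_measure[OF assms(2), of B]
      measure_nonneg[of M B] measure_nonneg[of M' B] by linarith
  then show "bdd_above ((\<lambda>A. \<bar>measure M A - measure M' A\<bar>) ` sets M)"
    by (intro bdd_aboveI2)
qed

lemma local_limit_tendsto:
  assumes "is_local_limit D E \<beta> n P" "A \<subseteq> trees_height_le n"
  shows "(\<lambda>N. measure (gibbs D E \<beta> N) (truncate_tree n -` A \<inter> space (gibbs D E \<beta> N)))
    \<longlonglongrightarrow> measure P A"
proof -
  define M where "M N = distr (gibbs D E \<beta> N) (count_space (trees_height_le n)) (truncate_tree n)" for N
  interpret P: prob_space P
    using assms(1) unfolding is_local_limit_def by blast
  have fin: "finite_measure (M N)" for N
    unfolding M_def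
    by (intro finite_measure.finite_measure_distr finite_measure_gibbs measurable_truncate_gibbs)
  have "(\<lambda>N. measure (M N) A - measure P A) \<longlonglongrightarrow> 0"
  proof (rule Lim_null_comparison)
    show "(\<lambda>N. tv_dist (M N) P) \<longlonglongrightarrow> 0"
      using assms(1) unfolding is_local_limit_def M_def by blast
    have "\<bar>measure (M N) A - measure P A\<bar> \<le> tv_dist (M N) P" for N
      using assms by (intro tv_dist_bound fin P.finite_measure_axioms) (simp add: M_def)
    then show "\<forall>\<^sub>F N in sequentially. norm (measure (M N) A - measure P A) \<le> tv_dist (M N) P"
      by simp
  qed
  then have "(\<lambda>N. measure (M N) A) \<longlonglongrightarrow> measure P A"
    by (rule LIM_zero_cancel)
  then show ?thesis
    using assms by (simp add: M_def measure_distr measurable_truncate_gibbs)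
qed

text \<open>An event at height \<open>m\<close> and its preimage at height \<open>n\<close> pull
  back to the same event of trees on \<open>N\<close> vertices. Their probabilities are thus limits
  of one and the same sequence.\<close>

lemma local_limit_truncate:
  assumes m: "is_local_limit D E \<beta> m P" and n: "is_local_limit D E \<beta> n P'" and "m \<le> n"
  shows "distr P' (count_space (trees_height_le m)) (truncate_tree m) = P"
proof -
  interpret P: prob_space P
    using m unfolding is_local_limit_def by blast
  interpret P': prob_space P'
    using n unfolding is_local_limit_def by blast
  have sets: "sets P = sets (count_space (trees_height_le m))"
      "sets P' = sets (count_space (trees_height_le n))"
    using m n by (simp_all only: is_local_limit_def)
  have meas: "truncate_tree m \<in> P' \<rightarrow>\<^sub>M count_space (trees_height_le m)"
    unfolding measurable_cong_sets[OF sets(2) refl] by (simp add: truncate_in_trees_height_le)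
  have space: "space P' = trees_height_le n"
    using sets_eq_imp_space_eq[OF sets(2)] by simp
  show ?thesis
  proof (rule measure_eqI)
    fix A assume "A \<in> sets (distr P' (count_space (trees_height_le m)) (truncate_tree m))"
    then have A: "A \<subseteq> trees_height_le m"
      by simp
    let ?B = "truncate_tree m -` A \<inter> trees_height_le n"
    have "truncate_tree n -` ?B = truncate_tree m -` A"
      using \<open>m \<le> n\<close> by (auto simp: truncate_truncate truncate_in_trees_height_le min_absorb1)
    then have "measure P' ?B = measure P A"
      using local_limit_tendsto[OF m A] local_limit_tendsto[OF n, of ?B] by (auto intro: LIMSEQ_unique)
    then show "emeasure (distr P' (count_space (trees_height_le m)) (truncate_tree m)) A = emeasure P A"
      using A meas by (simp add: emeasure_distr space P.emeasure_eq_measure P'.emeasure_eq_measure)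
  qed (simp add: sets)
qed

subsection \<open>Existence\<close>

text \<open>One set for all heights, so that a single enumeration codes the truncations at every
  height.\<close>

definition finite_trees :: "plane_tree set" where
  "finite_trees = (\<Union>n. range (truncate_tree n))"

text \<open>
  Kolmogorov's theorem is available for Polish spaces only, so the countably many possible
  truncations are coded in the discrete space of natural numbers.
\<close>

definition tree_index :: "plane_tree \<Rightarrow> nat discrete" where
  "tree_index T = discrete (to_nat_on finite_trees T)"

definition indexed_tree :: "nat discrete \<Rightarrow> plane_tree" where
  "indexed_tree i = from_nat_into finite_trees (of_discrete i)"

lemma indexed_tree_index [simp]: "indexed_tree (tree_index (truncate_tree n T)) = truncate_tree n T"
proof -
  have "countable finite_trees"
    unfolding finite_trees_def by (auto intro: countable_range_truncate)
  moreover have "truncate_tree n T \<in> finite_trees"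
    unfolding finite_trees_def by blast
  ultimately show ?thesis
    by (simp add: indexed_tree_def tree_index_def discrete_inverse)
qed

lemma measurable_borel_discrete:
  "(f :: nat discrete \<Rightarrow> 'a) \<in> borel \<rightarrow>\<^sub>M N \<longleftrightarrow> range f \<subseteq> space N"
  by (subst measurable_cong_sets[OF sets_borel_eq_count_space refl]) (simp add: Pi_iff image_subset_iff)

text \<open>Splitting by the countably many values of coordinate \<open>m\<close> leaves conditions
  on coordinate \<open>n\<close> alone.\<close>

lemma pred_PiM_discrete:
  assumes "m \<in> J" "n \<in> J"
  shows "Measurable.pred (\<Pi>\<^sub>M j\<in>J. (borel :: nat discrete measure)) (\<lambda>\<omega>. R (\<omega> m) (\<omega> n))"
proof (rule measurable_compose_countable[where f = "\<lambda>i \<omega>. R i (\<omega> n)" and g = "\<lambda>\<omega>. \<omega> m"])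
  have "R i \<in> (borel :: nat discrete measure) \<rightarrow>\<^sub>M count_space UNIV" for i
    by (simp add: measurable_borel_discrete)
  then show "Measurable.pred (\<Pi>\<^sub>M j\<in>J. (borel :: nat discrete measure)) (\<lambda>\<omega>. R i (\<omega> n))" for i
    by (rule measurable_compose[rotated]) (rule measurable_component_singleton[OF assms(2)])
  have "(\<lambda>i. i) \<in> (borel :: nat discrete measure) \<rightarrow>\<^sub>M count_space UNIV"
    by (simp add: measurable_borel_discrete)
  then show "(\<lambda>\<omega>. \<omega> m) \<in> (\<Pi>\<^sub>M j\<in>J. (borel :: nat discrete measure)) \<rightarrow>\<^sub>M count_space UNIV"
    by (rule measurable_compose[rotated]) (rule measurable_component_singleton[OF assms(1)])
qed

section \<open>Projective limit of the local limits, and the random tree\<close>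

locale consistent_truncations =
  fixes D :: nat and P :: "nat \<Rightarrow> plane_tree measure"
  assumes prob_space_P: "n \<ge> 1 \<Longrightarrow> prob_space (P n)"
    and sets_P: "n \<ge> 1 \<Longrightarrow> sets (P n) = sets (count_space (trees_height_le n))"
    and measure_P: "n \<ge> 1 \<Longrightarrow> measure (P n) (trees_of_height D n) = 1"
    and distr_P: "1 \<le> m \<Longrightarrow> m \<le> n \<Longrightarrow>
      distr (P n) (count_space (trees_height_le m)) (truncate_tree m) = P m"
begin

lemma measurable_P: "n \<ge> 1 \<Longrightarrow> f \<in> trees_height_le n \<rightarrow> space N \<Longrightarrow> f \<in> P n \<rightarrow>\<^sub>M N"
  by (subst measurable_cong_sets[OF sets_P refl]) auto

text \<open>The finite-dimensional laws for Kolmogorov's theorem: one tree is drawn and its coded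
  truncations are recorded jointly. Inserting 1 covers empty \<open>J\<close> and keeps the index of
  \<open>P\<close> at least 1.\<close>

definition joint :: "nat set \<Rightarrow> (nat \<Rightarrow> nat discrete) measure" where
  "joint J = distr (P (Max (insert 1 J))) (\<Pi>\<^sub>M j\<in>J. borel)
     (\<lambda>T. \<lambda>j\<in>J. tree_index (truncate_tree j T))"

text \<open>The truncations at heights in \<open>J\<close> factor through the one at the maximal
  height, so \<open>distr_P\<close> allows any larger height. Different index sets can then be
  compared at a common height.\<close>

lemma joint_eq:
  assumes "finite J" "n \<ge> 1" "\<And>j. j \<in> J \<Longrightarrow> j \<le> n"
  shows "joint J = distr (P n) (\<Pi>\<^sub>M j\<in>J. borel) (\<lambda>T. \<lambda>j\<in>J. tree_index (truncate_tree j T))"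
proof -
  let ?m = "Max (insert 1 J)"
  have m: "1 \<le> ?m" "?m \<le> n" "\<And>j. j \<in> J \<Longrightarrow> j \<le> ?m"
    using assms by auto
  have "joint J = distr (distr (P n) (count_space (trees_height_le ?m)) (truncate_tree ?m))
      (\<Pi>\<^sub>M j\<in>J. borel) (\<lambda>T. \<lambda>j\<in>J. tree_index (truncate_tree j T))"
    unfolding joint_def distr_P[OF m(1,2)] ..
  also have "\<dots> = distr (P n) (\<Pi>\<^sub>M j\<in>J. borel)
      ((\<lambda>T. \<lambda>j\<in>J. tree_index (truncate_tree j T)) \<circ> truncate_tree ?m)"
    using assms(2) by (intro distr_distr measurable_P)
      (auto simp: space_PiM truncate_in_trees_height_le)
  also have "(\<lambda>T. \<lambda>j\<in>J. tree_index (truncate_tree j T)) \<circ> truncate_tree ?m =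
      (\<lambda>T. \<lambda>j\<in>J. tree_index (truncate_tree j T))"
    using m(3) by (auto simp: fun_eq_iff truncate_truncate min_absorb1 restrict_def)
  finally show ?thesis .
qed

text \<open>With both laws realised at one height bounding \<open>H\<close>, passing from
  \<open>H\<close> to \<open>J\<close> just forgets coordinates recorded from the same tree.\<close>

sublocale joint: polish_projective UNIV joint
proof (intro polish_projective.intro projective_family.intro)
  fix J H :: "nat set" assume "J \<subseteq> H" "finite H"
  then have J: "finite J"
    by (auto intro: finite_subset)
  define n where "n = Max (insert 1 H)"
  have n: "n \<ge> 1" "\<And>j. j \<in> H \<Longrightarrow> j \<le> n"
    using \<open>finite H\<close> by (auto simp: n_def)
  have "joint H = distr (P n) (\<Pi>\<^sub>M j\<in>H. borel) (\<lambda>T. \<lambda>j\<in>H. tree_index (truncate_tree j T))"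
    by (rule joint_eq) (use n \<open>finite H\<close> in auto)
  then have "distr (joint H) (\<Pi>\<^sub>M j\<in>J. borel) (\<lambda>f. restrict f J) =
      distr (P n) (\<Pi>\<^sub>M j\<in>J. borel)
        ((\<lambda>f. restrict f J) \<circ> (\<lambda>T. \<lambda>j\<in>H. tree_index (truncate_tree j T)))"
    using \<open>J \<subseteq> H\<close> n(1)
    by (simp only:) (intro distr_distr measurable_P measurable_restrict_subset, auto simp: space_PiM)
  also have "(\<lambda>f. restrict f J) \<circ> (\<lambda>T. \<lambda>j\<in>H. tree_index (truncate_tree j T)) =
      (\<lambda>T. \<lambda>j\<in>J. tree_index (truncate_tree j T))"
    using \<open>J \<subseteq> H\<close> by (auto simp: fun_eq_iff restrict_def)
  also have "distr (P n) (\<Pi>\<^sub>M j\<in>J. borel) \<dots> = joint J"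
    using J n \<open>J \<subseteq> H\<close> by (intro joint_eq[symmetric]) auto
  finally show "joint J = distr (joint H) (\<Pi>\<^sub>M j\<in>J. borel) (\<lambda>f. restrict f J)" ..
next
  fix J :: "nat set" assume "finite J"
  then show "prob_space (joint J)"
    unfolding joint_def
    by (intro prob_space.prob_space_distr prob_space_P measurable_P) (auto simp: space_PiM)
qed

lemma measurable_restrict_lim:
  "(\<lambda>f. restrict f J) \<in> joint.lim \<rightarrow>\<^sub>M (\<Pi>\<^sub>M j\<in>J. borel)"
  unfolding measurable_cong_sets[OF joint.sets_lim refl] by (rule measurable_restrict_subset) simp

lemma distr_lim_joint:
  assumes "finite J"
  shows "distr joint.lim (\<Pi>\<^sub>M j\<in>J. borel) (\<lambda>f. restrict f J) = joint J"
proof (rule measure_eqI)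
  fix X assume "X \<in> sets (distr joint.lim (\<Pi>\<^sub>M j\<in>J. borel) (\<lambda>f. restrict f J))"
  then have X: "X \<in> sets (\<Pi>\<^sub>M j\<in>J. borel)"
    by simp
  have "(\<lambda>f. restrict f J) -` X \<inter> space joint.lim = joint.emb UNIV J X"
    by (simp add: prod_emb_def space_PiM)
  then show "emeasure (distr joint.lim (\<Pi>\<^sub>M j\<in>J. borel) (\<lambda>f. restrict f J)) X = emeasure (joint J) X"
    using X assms joint.emeasure_lim_emb[of J X]
    by (simp add: emeasure_distr[OF measurable_restrict_lim X])
qed (use assms in \<open>simp add: joint.sets_P\<close>)

text \<open>The outer truncation forces the value into \<open>trees_height_le n\<close>, even when
  the index codes a higher tree.\<close>

definition level_tree :: "(nat \<Rightarrow> nat discrete) \<Rightarrow> nat \<Rightarrow> plane_tree" where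
  "level_tree \<omega> n = truncate_tree n (indexed_tree (\<omega> n))"

lemma measurable_level_tree:
  assumes "n \<in> J"
  shows "(\<lambda>\<omega>. level_tree \<omega> n) \<in> (\<Pi>\<^sub>M j\<in>J. borel) \<rightarrow>\<^sub>M count_space (trees_height_le n)"
proof -
  have "(\<lambda>i. truncate_tree n (indexed_tree i)) \<in> borel \<rightarrow>\<^sub>M count_space (trees_height_le n)"
    by (auto simp: measurable_borel_discrete truncate_in_trees_height_le)
  then show ?thesis
    unfolding level_tree_def
    by (rule measurable_compose[rotated]) (rule measurable_component_singleton[OF assms])
qed

lemma measurable_level_tree_lim:
  "(\<lambda>\<omega>. level_tree \<omega> n) \<in> joint.lim \<rightarrow>\<^sub>M count_space (trees_height_le n)"
  unfolding measurable_cong_sets[OF joint.sets_lim refl] by (rule measurable_level_tree) simp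

definition coherent :: "(nat \<Rightarrow> nat discrete) \<Rightarrow> bool" where
  "coherent \<omega> \<longleftrightarrow> (\<forall>n. truncate_tree n (level_tree \<omega> (Suc n)) = level_tree \<omega> n \<and>
     level_tree \<omega> n \<in> trees D)"

lemma truncate_limit_level_tree:
  "coherent \<omega> \<Longrightarrow> truncate_tree n (limit_tree (level_tree \<omega>)) = level_tree \<omega> n"
  by (rule truncate_limit_tree) (auto simp: coherent_def)

text \<open>Each of the countably many conditions concerns the coordinates \<open>n\<close> and
  \<open>Suc n\<close> only. Their joint law comes from truncating a single tree under
  \<open>P (Suc n)\<close>, where coherence holds by \<open>truncate_truncate\<close>.\<close>

lemma AE_coherent: "AE \<omega> in joint.lim. coherent \<omega>"
proof -
  have "AE \<omega> in joint.lim. truncate_tree n (level_tree \<omega> (Suc n)) = level_tree \<omega> n \<and>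
      level_tree \<omega> n \<in> trees D" for n
  proof -
    let ?J = "{n, Suc n}"
    let ?C = "\<lambda>\<omega>. truncate_tree n (level_tree \<omega> (Suc n)) = level_tree \<omega> n \<and> level_tree \<omega> n \<in> trees D"
    let ?h = "\<lambda>T. \<lambda>j\<in>?J. tree_index (truncate_tree j T)"
    have pred: "Measurable.pred (\<Pi>\<^sub>M j\<in>J. borel) ?C" if "n \<in> J" "Suc n \<in> J" for J
      unfolding level_tree_def by (rule pred_PiM_discrete[OF that])
    interpret S: prob_space "P (Suc n)"
      by (rule prob_space_P) simp
    have "AE T in P (Suc n). T \<in> trees_of_height D (Suc n)"
    proof (rule S.prob_eq_1[THEN iffD1])
      show "trees_of_height D (Suc n) \<in> S.events"
        using sets_P[of "Suc n"] by (simp add: trees_of_height_subset)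
    qed (simp add: measure_P)
    then have AE_h: "AE T in P (Suc n). ?C (?h T)"
      by eventually_elim
        (auto simp: level_tree_def truncate_truncate trees_of_height_def truncate_in_trees
          simp del: truncate_tree.simps)
    have h: "?h \<in> P (Suc n) \<rightarrow>\<^sub>M (\<Pi>\<^sub>M j\<in>?J. borel)"
      by (rule measurable_P) (auto simp: space_PiM)
    have C: "{\<omega> \<in> space (\<Pi>\<^sub>M j\<in>?J. borel). ?C \<omega>} \<in> sets (\<Pi>\<^sub>M j\<in>?J. borel)"
      using pred[of ?J] by (simp only: pred_def insert_iff simp_thms)
    have "AE \<omega> in distr (P (Suc n)) (\<Pi>\<^sub>M j\<in>?J. borel) ?h. ?C \<omega>"
      by (rule AE_distr_iff[OF h C, THEN iffD2]) (rule AE_h)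
    moreover have "joint ?J = distr (P (Suc n)) (\<Pi>\<^sub>M j\<in>?J. borel) ?h"
      by (rule joint_eq) auto
    ultimately have "AE \<omega> in joint ?J. ?C \<omega>"
      by (simp only:)
    then have "AE \<omega> in distr joint.lim (\<Pi>\<^sub>M j\<in>?J. borel) (\<lambda>f. restrict f ?J). ?C \<omega>"
      by (subst distr_lim_joint) auto
    then have "AE \<omega> in joint.lim. ?C (restrict \<omega> ?J)"
      by (rule AE_distrD[OF measurable_restrict_lim])
    \<comment> \<open>\<open>?C\<close> looks only at coordinates in \<open>?J\<close>, so the
      restriction disappears.\<close>
    then show ?thesis
      by (simp add: level_tree_def)
  qed
  then show ?thesis
    unfolding coherent_def by (simp add: AE_all_countable)
qed

text \<open>The single vertex is a default on the null set of incoherent sequences; it keeps every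
  value in \<open>trees D\<close>.\<close>

definition random_tree :: "(nat \<Rightarrow> nat discrete) \<Rightarrow> plane_tree" where
  "random_tree \<omega> = (if coherent \<omega> then limit_tree (level_tree \<omega>) else Node [])"

lemma truncate_Node_Nil: "truncate_tree n (Node []) = Node []"
  by (cases n) auto

lemma random_tree_in_trees: "random_tree \<omega> \<in> trees D"
proof (cases "coherent \<omega>")
  case True
  then have "level_tree \<omega> n \<in> trees D" for n
    by (simp add: coherent_def)
  with True have "truncate_tree n (random_tree \<omega>) \<in> trees D" for n
    by (simp add: random_tree_def truncate_limit_level_tree)
  then show ?thesis
    by (rule treesI_truncate)
next
  case False
  have "tree_level (Node []) n = (if n = 0 then [Node []] else [])" for n
    by (induction n) auto
  with False show ?thesis
    by (auto simp: random_tree_def trees_def vertices_def level_size_def branching_def)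
qed

text \<open>On coherent sequences the truncation at \<open>n\<close> gives back
  \<open>level_tree \<omega> n\<close>, which depends on one coordinate, so it remains to see that
  coherence is an event.\<close>

lemma measurable_random_tree: "random_tree \<in> joint.lim \<rightarrow>\<^sub>M tree_space D"
proof (rule measurable_tree_spaceI)
  show "random_tree \<omega> \<in> trees D" for \<omega>
    by (rule random_tree_in_trees)
  have [measurable]: "(\<lambda>\<omega>. level_tree \<omega> n) \<in> joint.lim \<rightarrow>\<^sub>M count_space UNIV" for n
    by (rule measurable_compose[OF measurable_level_tree_lim]) simp
  have [measurable]: "Measurable.pred joint.lim coherent"
    unfolding coherent_def measurable_cong_sets[OF joint.sets_lim refl] level_tree_def
    by (intro pred_intros_countable pred_PiM_discrete) auto
  fix n :: nat
  have "(\<lambda>\<omega>. if coherent \<omega> then level_tree \<omega> n else Node []) \<in> joint.lim \<rightarrow>\<^sub>M count_space UNIV"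
    by measurable
  also have "(\<lambda>\<omega>. if coherent \<omega> then level_tree \<omega> n else Node []) =
      (\<lambda>\<omega>. truncate_tree n (random_tree \<omega>))"
    by (auto simp: fun_eq_iff random_tree_def truncate_limit_level_tree truncate_Node_Nil)
  finally show "(\<lambda>\<omega>. truncate_tree n (random_tree \<omega>)) \<in> joint.lim \<rightarrow>\<^sub>M count_space UNIV" .
qed

lemma consistent_random_tree: "consistent_with D P (distr joint.lim (tree_space D) random_tree)"
proof -
  have "distr (distr joint.lim (tree_space D) random_tree) (count_space (trees_height_le n)) (truncate_tree n) = P n"
    if "n \<ge> 1" for n
  proof -
    let ?N = "count_space (trees_height_le n)"
    have "distr (distr joint.lim (tree_space D) random_tree) ?N (truncate_tree n) =
        distr joint.lim ?N (truncate_tree n \<circ> random_tree)"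
      by (rule distr_distr[OF measurable_truncate measurable_random_tree])
    also have "\<dots> = distr joint.lim ?N (\<lambda>\<omega>. level_tree \<omega> n)"
    proof (rule distr_cong_AE)
      show "AE \<omega> in joint.lim. (truncate_tree n \<circ> random_tree) \<omega> = level_tree \<omega> n"
        using AE_coherent
        by eventually_elim (simp add: random_tree_def truncate_limit_level_tree)
      show "truncate_tree n \<circ> random_tree \<in> joint.lim \<rightarrow>\<^sub>M ?N"
        by (rule measurable_comp[OF measurable_random_tree measurable_truncate])
    qed (simp_all add: measurable_level_tree_lim)
    \<comment> \<open>Only coordinate \<open>n\<close> matters, so the law is determined by the
      marginal \<open>joint {n}\<close>, the coded image of \<open>P n\<close>.\<close>
    also have "\<dots> = distr joint.lim ?N ((\<lambda>\<omega>. level_tree \<omega> n) \<circ> (\<lambda>f. restrict f {n}))"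
      by (simp add: comp_def level_tree_def)
    also have "\<dots> = distr (distr joint.lim (\<Pi>\<^sub>M j\<in>{n}. borel) (\<lambda>f. restrict f {n})) ?N
        (\<lambda>\<omega>. level_tree \<omega> n)"
      by (rule distr_distr[OF measurable_level_tree measurable_restrict_lim, symmetric]) simp
    also have "\<dots> = distr (distr (P n) (\<Pi>\<^sub>M j\<in>{n}. borel)
        (\<lambda>T. \<lambda>j\<in>{n}. tree_index (truncate_tree j T))) ?N (\<lambda>\<omega>. level_tree \<omega> n)"
      using that by (subst distr_lim_joint, simp, subst joint_eq[of "{n}" n]) auto
    also have "\<dots> = distr (P n) ?N
        ((\<lambda>\<omega>. level_tree \<omega> n) \<circ> (\<lambda>T. \<lambda>j\<in>{n}. tree_index (truncate_tree j T)))"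
      by (rule distr_distr[OF measurable_level_tree measurable_P]) (use that in \<open>auto simp: space_PiM\<close>)
    also have "\<dots> = distr (P n) ?N (truncate_tree n)"
      by (simp add: comp_def level_tree_def truncate_truncate)
    \<comment> \<open>The case \<open>m = n\<close> of \<open>distr_P\<close>: truncation at height
      \<open>n\<close> preserves \<open>P n\<close>.\<close>
    also have "\<dots> = P n"
      using that by (intro distr_P) auto
    finally show ?thesis .
  qed
  then show ?thesis
    by (auto simp: consistent_with_def measurable_truncate)
qed

end

theorem theorem5:
  fixes D :: nat and E :: "nat \<Rightarrow> real" and \<beta> :: real
    and P :: "nat \<Rightarrow> plane_tree measure"
  assumes "D \<ge> 1"
    and "\<And>n. n \<ge> 1 \<Longrightarrow> is_local_limit D E \<beta> n (P n)"
  shows "(\<exists>!Q. consistent_with D P Q) \<and>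
    (\<forall>Q. consistent_with D P Q \<longrightarrow>
       prob_space Q \<and> infinite_trees D \<in> sets Q \<and> measure Q (infinite_trees D) = 1)"
proof -
  \<comment> \<open>The Gibbs measures enter only here, through
    \<open>local_limit_truncate\<close>.\<close>
  interpret consistent_truncations D P
  proof (rule consistent_truncations.intro)
    fix n :: nat assume n: "1 \<le> n"
    show "prob_space (P n)" "sets (P n) = sets (count_space (trees_height_le n))"
      "measure (P n) (trees_of_height D n) = 1"
      using assms(2)[OF n] unfolding is_local_limit_def by blast+
  next
    fix m n :: nat assume "1 \<le> m" "m \<le> n"
    then have "is_local_limit D E \<beta> m (P m)" "is_local_limit D E \<beta> n (P n)"
      by (simp_all only: assms(2) order.trans[of 1 m n])
    then show "distr (P n) (count_space (trees_height_le m)) (truncate_tree m) = P m"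
      using \<open>m \<le> n\<close> by (rule local_limit_truncate)
  qed
  have prob_P1: "prob_space (P 1)"
    by (rule prob_space_P) simp
  have "\<exists>!Q. consistent_with D P Q"
    using consistent_random_tree consistent_unique[OF _ consistent_random_tree prob_P1] by (rule ex1I)
  moreover have "prob_space Q \<and> infinite_trees D \<in> sets Q \<and> measure Q (infinite_trees D) = 1"
    if Q: "consistent_with D P Q" for Q
  proof (intro conjI)
    show "prob_space Q"
      by (rule consistent_prob_space[OF Q prob_P1])
    show "infinite_trees D \<in> sets Q"
      using Q infinite_trees_in_sets by (simp add: consistent_with_def)
    show "measure Q (infinite_trees D) = 1"
      by (rule consistent_infinite_trees[OF Q prob_space_P measure_P])
  qed
  ultimately show ?thesis
    by blast
qed

end
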